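(* Let $q$ be complex with $0<|q|<1$, let $b,c,d$ be complex numbers with $d\ne0$, and define $$G(a):=\sum_{k=0}^{\infty}\left(1-abcq^{3k-1}\right)\frac{(abc/q,d,q/d;q)_k\,(ac/q,ab/q,bcq;q^2)_k}{(q^2,abcq/d,abcd;q^2)_k\,(a/q,bq,cq;q)_k}\,q^k .$$ Then for every complex $a$ for which no denominator in $G(a)$, in $G(0)$, or in the formula below vanishes, $$G(a)=\frac{(abc/q;q)_\infty(a/d;q^2)_\infty(ad/q;q^2)_\infty}{(a/q;q)_\infty(abcq/d;q^2)_\infty(abcd;q^2)_\infty}\,G(0)$$ $$-a\,\frac{(abc/q,d,q/d;q)_\infty}{(q^2,abcq/d,abcd;q^2)_\infty}\,\frac{(acq,abq,bcq;q^2)_\infty}{(a/q,bq,cq;q)_\infty}\sum_{k=0}^\infty\frac{(a/d,ad/q;q^2)_k}{(acq,abq;q^2)_k}\,q^{2k-1}.$$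
   Context: $(a;q)_\infty=\prod_{j\ge0}(1-aq^j)$, $(a;q)_m=\prod_{j=0}^{m-1}(1-aq^j)$ for integers $m\ge 0$, and $(a_1,\dots,a_r;q)_m=\prod_{i=1}^r(a_i;q)_m$ for $m\in\{0,1,2,\dots\}\cup\{\infty\}$. *)

theory Defs
  imports "HOL-Analysis.Analysis"
begin

definition qpoch :: "complex \<Rightarrow> complex \<Rightarrow> nat \<Rightarrow> complex" where
  "qpoch a q m = (\<Prod>j<m. 1 - a * q ^ j)"

text \<open>For norm q < 1 the product converges for every a in the sense of \<^const>\<open>has_prod\<close>,
  which permits finitely many zero factors; in that case its value is 0.\<close>
definition qpoch_inf :: "complex \<Rightarrow> complex \<Rightarrow> complex" where
  "qpoch_inf a q = prodinf (\<lambda>j. 1 - a * q ^ j)"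

definition qpochs :: "complex list \<Rightarrow> complex \<Rightarrow> nat \<Rightarrow> complex" where
  "qpochs as q m = prod_list (map (\<lambda>a. qpoch a q m) as)"

definition qpochs_inf :: "complex list \<Rightarrow> complex \<Rightarrow> complex" where
  "qpochs_inf as q = prod_list (map (\<lambda>a. qpoch_inf a q) as)"

definition G_den :: "complex \<Rightarrow> complex \<Rightarrow> complex \<Rightarrow> complex \<Rightarrow> complex \<Rightarrow> nat \<Rightarrow> complex" where
  "G_den q b c d a k =
     qpochs [q^2, a*b*c*q/d, a*b*c*d] (q^2) k * qpochs [a/q, b*q, c*q] q k"

text \<open>The exponent 3k-1 is an integer exponent: it equals -1 for k = 0.\<close>
definition G :: "complex \<Rightarrow> complex \<Rightarrow> complex \<Rightarrow> complex \<Rightarrow> complex \<Rightarrow> complex" where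
  "G q b c d a =
     (\<Sum>k. (1 - a*b*c * q powi (3 * int k - 1))
          * (qpochs [a*b*c/q, d, q/d] q k * qpochs [a*c/q, a*b/q, b*c*q] (q^2) k
             / G_den q b c d a k)
          * q ^ k)"

end

theory Submission
  imports Defs
begin

text \<open>
  The contiguous relation \<open>G(a) = R(a) G(aq\<^sup>2) - S(a)\<close>, where \<open>R\<close> is a rational function and
  \<open>S\<close> a quotient of infinite products, holds because the difference of the two series
  telescopes: the sum of \<open>t\<^sub>k(a) - R(a) t\<^sub>k(aq\<^sup>2)\<close> over \<open>k \<le> K\<close>, with \<open>t\<^sub>k\<close> the \<open>k\<close>-th term of \<open>G\<close>,
  is a product of shifted factorials that tends to \<open>-S(a)\<close>.  Iterating the relation,
  the products of the factors \<open>R\<close> converge to the coefficient of \<open>G(0)\<close>, the contributions of \<open>S\<close>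
  add up to the second series, and \<open>G(aq\<^bsup>2n\<^esup>)\<close> tends to \<open>G(0)\<close> by dominated convergence.
\<close>

section \<open>Finite and infinite shifted factorials\<close>

lemma qpoch_0 [simp]: "qpoch a q 0 = 1"
  by (simp add: qpoch_def)

lemma qpoch_zero_left [simp]: "qpoch 0 q n = 1"
  by (simp add: qpoch_def)

lemma qpoch_Suc: "qpoch a q (Suc n) = qpoch a q n * (1 - a * q ^ n)"
  by (simp add: qpoch_def)

lemma qpoch_add: "qpoch a q (m + n) = qpoch a q m * qpoch (a * q ^ m) q n"
  by (induction n) (simp_all add: qpoch_Suc power_add mult_ac)

text \<open>Both sides are the same product of \<open>n + 1\<close> factors, with the first or the
  last one split off. The form without division stays valid when \<open>1 - a\<close>
  vanishes.\<close>

lemma qpoch_shift: "(1 - a) * qpoch (a * q) q n = qpoch a q n * (1 - a * q ^ n)"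
  using qpoch_add[of a q 1 n] qpoch_Suc[of a q n] by (simp add: qpoch_Suc)

lemma qpoch_shift2:
  "(1 - a) * (1 - a * q) * qpoch (a * q ^ 2) q n
     = qpoch a q n * (1 - a * q ^ n) * (1 - a * q ^ Suc n)"
  using qpoch_add[of a q 2 n] by (simp add: qpoch_Suc numeral_2_eq_2)

text \<open>The geometric series makes the product absolutely convergent. Zero factors do no harm:
  \<open>convergent_prod\<close> admits finitely many, and the limit is then 0.\<close>

lemma qpoch_LIMSEQ:
  assumes "norm q < 1"
  shows "(\<lambda>n. qpoch a q n) \<longlonglongrightarrow> qpoch_inf a q"
proof -
  have "summable (\<lambda>n. norm a * norm q ^ n)"
    using assms by (intro summable_mult summable_geometric) simp
  then have "abs_convergent_prod (\<lambda>n. 1 - a * q ^ n)"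
    by (simp add: abs_convergent_prod_conv_summable norm_mult norm_power)
  then have "convergent_prod (\<lambda>n. 1 - a * q ^ n)"
    by (rule abs_convergent_prod_imp_convergent_prod)
  from convergent_prod_LIMSEQ[OF this] show ?thesis
    unfolding qpoch_def qpoch_inf_def LIMSEQ_lessThan_iff_atMost .
qed

lemma qpoch_inf_split:
  assumes "norm q < 1"
  shows "qpoch_inf a q = qpoch a q m * qpoch_inf (a * q ^ m) q"
proof (rule LIMSEQ_unique)
  show "(\<lambda>n. qpoch a q (m + n)) \<longlonglongrightarrow> qpoch_inf a q"
    using LIMSEQ_ignore_initial_segment[OF qpoch_LIMSEQ[OF assms], of a m]
    by (simp add: add.commute)
  show "(\<lambda>n. qpoch a q (m + n)) \<longlonglongrightarrow> qpoch a q m * qpoch_inf (a * q ^ m) q"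
    unfolding qpoch_add by (intro tendsto_intros qpoch_LIMSEQ assms)
qed

text \<open>By \<open>qpoch_inf_split\<close> the finite product divides the infinite one. The
  convergence lemmas below therefore assume only that infinite products do not vanish, and this
  covers every finite denominator.\<close>

lemma qpoch_nonzero:
  assumes "norm q < 1" "qpoch_inf a q \<noteq> 0"
  shows "qpoch a q n \<noteq> 0"
  using qpoch_inf_split[OF assms(1), of a n] assms(2) by auto

lemma qpoch_inf_shift_nonzero:
  assumes "norm q < 1" "qpoch_inf a q \<noteq> 0"
  shows "qpoch_inf (a * q ^ n) q \<noteq> 0"
  using qpoch_inf_split[OF assms(1), of a n] assms(2) by auto

section \<open>Bounds for shifted factorials, uniform in length and shift\<close>

lemma norm_qpoch_le:
  assumes "norm q < 1" "norm a \<le> r"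
  shows "norm (qpoch a q n) \<le> exp (r / (1 - norm q))"
proof -
  have r: "0 \<le> r"
    using assms(2) norm_ge_zero[of a] by linarith
  have sm: "summable (\<lambda>j. norm q ^ j)"
    using assms(1) by (intro summable_geometric) simp
  \<comment> \<open>Bounding each factor by an exponential turns the product into a geometric sum in
    the exponent, so the final bound does not depend on \<open>n\<close>.\<close>
  have "norm (1 - a * q ^ j) \<le> exp (r * norm q ^ j)" for j
  proof -
    have "norm (1 - a * q ^ j) \<le> 1 + norm a * norm q ^ j"
      using norm_triangle_ineq4[of 1 "a * q ^ j"] by (simp add: norm_mult norm_power)
    also have "\<dots> \<le> 1 + r * norm q ^ j"
      using assms by (simp add: mult_right_mono)
    also have "\<dots> \<le> exp (r * norm q ^ j)"
      by (rule exp_ge_add_one_self)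
    finally show ?thesis .
  qed
  then have "norm (qpoch a q n) \<le> (\<Prod>j<n. exp (r * norm q ^ j))"
    unfolding qpoch_def prod_norm[symmetric] by (intro prod_mono) auto
  also have "\<dots> = exp (r * (\<Sum>j<n. norm q ^ j))"
    by (simp add: exp_sum sum_distrib_left)
  also have "(\<Sum>j<n. norm q ^ j) \<le> (\<Sum>j. norm q ^ j)"
    using sm by (intro sum_le_suminf) auto
  also have "(\<Sum>j. norm q ^ j) = 1 / (1 - norm q)"
    using assms(1) by (intro suminf_geometric) simp
  finally show ?thesis
    using r by (simp add: mult_left_mono)
qed

lemma qpoch_shift_bounded:
  assumes "norm q < 1" "norm p \<le> 1"
  shows "\<exists>M. \<forall>n k. norm (qpoch (a * p ^ n) q k) \<le> M"
proof (intro exI allI)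
  fix n k
  have "norm (a * p ^ n) \<le> norm a"
    using assms(2) by (simp add: norm_mult norm_power mult_left_le power_le_one)
  then show "norm (qpoch (a * p ^ n) q k) \<le> exp (norm a / (1 - norm q))"
    by (rule norm_qpoch_le[OF assms(1)])
qed

text \<open>The shifted product is the quotient of the products of lengths \<open>n + k\<close> and
  \<open>n\<close> with the unshifted argument. Inverses of the latter products converge, since
  their limit is nonzero, and hence are bounded.\<close>

lemma inverse_qpoch_shift_bounded:
  assumes "norm q < 1" "qpoch_inf a q \<noteq> 0"
  shows "\<exists>M. \<forall>n k. norm (inverse (qpoch (a * q ^ n) q k)) \<le> M"
proof -
  have "(\<lambda>n. inverse (qpoch a q n)) \<longlonglongrightarrow> inverse (qpoch_inf a q)"
    by (intro tendsto_inverse qpoch_LIMSEQ assms)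
  then obtain M where M: "norm (inverse (qpoch a q n)) \<le> M" for n
    by (metis BseqE convergentI convergent_imp_Bseq)
  show ?thesis
  proof (intro exI allI)
    fix n k
    have "inverse (qpoch (a * q ^ n) q k) = qpoch a q n * inverse (qpoch a q (n + k))"
      using qpoch_nonzero[OF assms, of n] by (simp add: qpoch_add)
    also have "norm \<dots> \<le> exp (norm a / (1 - norm q)) * M"
      unfolding norm_mult
      by (intro mult_mono M norm_qpoch_le assms) auto
    finally show "norm (inverse (qpoch (a * q ^ n) q k)) \<le> exp (norm a / (1 - norm q)) * M" .
  qed
qed

text \<open>Serves as an introduction rule that reduces the bound for a long product to bounds for
  its factors.\<close>

lemma uniformly_bounded_mult:
  fixes f g :: "'a \<Rightarrow> 'b \<Rightarrow> 'c :: real_normed_algebra"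
  assumes "\<exists>M. \<forall>n k. norm (f n k) \<le> M" "\<exists>M. \<forall>n k. norm (g n k) \<le> M"
  shows "\<exists>M. \<forall>n k. norm (f n k * g n k) \<le> M"
proof -
  obtain M N where M: "norm (f n k) \<le> M" and N: "norm (g n k) \<le> N" for n k
    using assms by metis
  show ?thesis
  proof (intro exI allI)
    fix n k
    show "norm (f n k * g n k) \<le> M * N"
      by (rule order.trans[OF norm_mult_ineq])
         (intro mult_mono M N norm_ge_zero order.trans[OF norm_ge_zero M])
  qed
qed

section \<open>The contiguous relation\<close>

text \<open>The telescoping identity with \<open>\<alpha> = a/q\<close>, \<open>e = q/d\<close> and \<open>x = q\<^sup>k\<close>, which makes it polynomial;
  the factor \<open>1 - \<alpha>\<^sup>2bcx\<^sup>2\<close> was found by rational interpolation of the partial sums.\<close>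
lemma certificate:
  fixes \<alpha> b c d e x :: complex
  shows "x * (1 - \<alpha>*b*c*x^3) * (1 - \<alpha>*b) * (1 - \<alpha>*c)
      * (1 - \<alpha>*(d*e)*b*c*e*x^2) * (1 - \<alpha>*(d*e)*b*c*d*x^2) * (1 - \<alpha>*x) * (1 - \<alpha>*(d*e)*x)
    - x * (1 - \<alpha>*(d*e)^2*b*c*x^3) * (1 - \<alpha>*b*c*x) * (1 - \<alpha>*(d*e)*b*c*x)
      * (1 - \<alpha>*d) * (1 - \<alpha>*e) * (1 - \<alpha>*b*x^2) * (1 - \<alpha>*c*x^2)
    = (1 - x^2) * (1 - \<alpha>*(d*e)*b*c*e*x^2) * (1 - \<alpha>*(d*e)*b*c*d*x^2) * (1 - \<alpha>*(d*e)*x)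
      * (1 - b*x) * (1 - c*x) * (\<alpha> * (1 - \<alpha>^2*b*c*x^2))
    - (1 - \<alpha>*b*c*x) * (1 - d*x) * (1 - e*x) * (1 - \<alpha>*b*x^2) * (1 - \<alpha>*c*x^2)
      * (1 - b*c*(d*e)*x^2) * (\<alpha> * (1 - \<alpha>^2*b*c*(d*e)^2*x^2))"
  by algebra

text \<open>This is \<open>certificate\<close> at \<open>x = 1\<close> with the common factor
  \<open>(1 - \<alpha>*b) * (1 - \<alpha>*c)\<close> cancelled. It is the start of the telescoping,
  where that factor may be zero and so cannot be divided out.\<close>

lemma certificate_start:
  fixes \<alpha> b c d e :: complex
  shows "(1 - \<alpha>*b*c) * (1 - \<alpha>*(d*e)*b*c*e) * (1 - \<alpha>*(d*e)*b*c*d) * (1 - \<alpha>) * (1 - \<alpha>*(d*e))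
    - (1 - \<alpha>*(d*e)^2*b*c) * (1 - \<alpha>*b*c) * (1 - \<alpha>*(d*e)*b*c) * (1 - \<alpha>*d) * (1 - \<alpha>*e)
    = - (1 - \<alpha>*b*c) * (1 - d) * (1 - e) * (1 - b*c*(d*e)) * (\<alpha> * (1 - \<alpha>^2*b*c*(d*e)^2))"
  by algebra

section \<open>The summands and the ingredients of the contiguous relation\<close>

definition G_term :: "complex \<Rightarrow> complex \<Rightarrow> complex \<Rightarrow> complex \<Rightarrow> complex \<Rightarrow> nat \<Rightarrow> complex" where
  "G_term q b c d a k =
     (1 - a*b*c * q powi (3 * int k - 1))
       * (qpochs [a*b*c/q, d, q/d] q k * qpochs [a*c/q, a*b/q, b*c*q] (q^2) k
          / G_den q b c d a k)
       * q ^ k"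

text \<open>The function \<open>R\<close>. The products \<open>a*b*c/q*q\<close> and
  \<open>a/q*q\<close> are left unsimplified so that they show the first two factors of a shifted
  factorial in base \<open>q\<close>, as in \<open>qpoch_shift2\<close>.\<close>

definition step_ratio :: "complex \<Rightarrow> complex \<Rightarrow> complex \<Rightarrow> complex \<Rightarrow> complex \<Rightarrow> complex" where
  "step_ratio q b c d a =
     ((1 - a*b*c/q) * (1 - a*b*c/q*q) * (1 - a/d) * (1 - a*d/q))
     / ((1 - a/q) * (1 - a/q*q) * (1 - a*b*c*q/d) * (1 - a*b*c*d))"

text \<open>The closed form of the telescoping partial sum up to index \<open>k\<close>. The lengths
  \<open>k\<close>, \<open>Suc k\<close> and \<open>Suc (Suc k)\<close> record which factors remain
  after putting both series over a common denominator.\<close>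

definition step_sum :: "complex \<Rightarrow> complex \<Rightarrow> complex \<Rightarrow> complex \<Rightarrow> complex \<Rightarrow> nat \<Rightarrow> complex" where
  "step_sum q b c d a k =
     (- (a/q) * (1 - a^2*b*c * (q^2)^k))
     * (qpochs [a*b*c/q, d, q/d] q (Suc k) * qpochs [a*c*q, a*b*q] (q^2) k
        * qpoch (b*c*q) (q^2) (Suc k))
     / (qpoch (q^2) (q^2) k * qpochs [a*b*c*q/d, a*b*c*d] (q^2) (Suc k)
        * qpoch (a/q) q (Suc (Suc k)) * qpochs [b*q, c*q] q k)"

text \<open>The function \<open>S\<close>; its negative is the limit of
  \<open>step_sum\<close>.\<close>

definition step_defect :: "complex \<Rightarrow> complex \<Rightarrow> complex \<Rightarrow> complex \<Rightarrow> complex \<Rightarrow> complex" where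
  "step_defect q b c d a =
     a / q * (qpochs_inf [a*b*c/q, d, q/d] q * qpochs_inf [a*c*q, a*b*q, b*c*q] (q^2))
     / (qpochs_inf [q^2, a*b*c*q/d, a*b*c*d] (q^2) * qpochs_inf [a/q, b*q, c*q] q)"

lemma G_eq_suminf: "G q b c d a = (\<Sum>k. G_term q b c d a k)"
  unfolding G_def G_term_def ..

lemma qpochs_Cons [simp]: "qpochs (a # as) q n = qpoch a q n * qpochs as q n"
  and qpochs_Nil [simp]: "qpochs [] q n = 1"
  and qpochs_inf_Cons [simp]: "qpochs_inf (a # as) q = qpoch_inf a q * qpochs_inf as q"
  and qpochs_inf_Nil [simp]: "qpochs_inf [] q = 1"
  by (simp_all add: qpochs_def qpochs_inf_def)

lemma power_int_term:
  fixes q :: complex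
  assumes "q \<noteq> 0"
  shows "q powi (3 * int k - 1) = (q ^ k) ^ 3 / q"
proof -
  have "q powi (3 * int k - 1) = q powi int (k * 3) / q"
    using assms by (simp add: power_int_diff mult.commute)
  then show ?thesis
    by (simp only: power_int_of_nat power_mult)
qed

text \<open>All four quantities are multiples of one product \<open>K\<close>. Dividing by it leaves
  a polynomial identity, namely that of \<open>certificate\<close> with \<open>x\<close> equal to
  \<open>q ^ Suc k\<close>.\<close>

lemma step_partial_sum_Suc:
  assumes q: "q \<noteq> 0" and d: "d \<noteq> 0"
    and nz: "\<And>n. qpoch (q^2) (q^2) n \<noteq> 0" "\<And>n. qpoch (a*b*c*q/d) (q^2) n \<noteq> 0"
      "\<And>n. qpoch (a*b*c*d) (q^2) n \<noteq> 0" "\<And>n. qpoch (a/q) q n \<noteq> 0"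
      "\<And>n. qpoch (b*q) q n \<noteq> 0" "\<And>n. qpoch (c*q) q n \<noteq> 0"
  shows "G_term q b c d a (Suc k) - step_ratio q b c d a * G_term q b c d (a*q^2) (Suc k)
    = step_sum q b c d a (Suc k) - step_sum q b c d a k"
proof -
  define x where "x = q ^ Suc k"
  define A where "A = qpoch (a*b*c/q) q (Suc k)"
  define D where "D = qpoch d q (Suc k)"
  define E where "E = qpoch (q/d) q (Suc k)"
  define F where "F = qpoch (a*c*q) (q^2) k"
  define H where "H = qpoch (a*b*q) (q^2) k"
  define J where "J = qpoch (b*c*q) (q^2) (Suc k)"
  define Q where "Q = qpoch (q^2) (q^2) k"
  define M where "M = qpoch (a*b*c*q/d) (q^2) (Suc k)"
  define N where "N = qpoch (a*b*c*d) (q^2) (Suc k)"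
  define L where "L = qpoch (a/q) q (Suc k)"
  define B where "B = qpoch (b*q) q k"
  define C where "C = qpoch (c*q) q k"
  \<comment> \<open>The linear factors by which the denominators differ: \<open>y\<close> extends
    \<open>Q\<close>, \<open>B\<close>, \<open>C\<close> by one factor each, \<open>m\<close> and
    \<open>n\<close> extend \<open>M\<close> and \<open>N\<close>, while \<open>g\<close> and
    \<open>h\<close> are the next two factors of \<open>L\<close>.\<close>
  define y where "y = (1 - x^2) * (1 - b*x) * (1 - c*x)"
  define m where "m = 1 - a*b*c*q/d*x^2"
  define n where "n = 1 - a*b*c*d*x^2"
  define g where "g = 1 - a/q*x"
  define h where "h = 1 - a*x"
  define K where "K = A * D * E * F * H * J / (Q * M * N * L * B * C * y)"
  have qk: "q ^ k = x / q" and q2k: "(q^2) ^ k = x^2 / q^2" and q2k': "(q^2) ^ Suc k = x^2"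
    and qk': "q ^ Suc k = x" and qk'': "q ^ Suc (Suc k) = x * q"
    using q by (simp_all add: x_def power_mult_distrib power2_eq_square)
  have Q': "qpoch (q^2) (q^2) (Suc k) = Q * (1 - x^2)"
    using q by (simp add: Q_def qpoch_Suc q2k)
  have B': "qpoch (b*q) q (Suc k) = B * (1 - b*x)" and C': "qpoch (c*q) q (Suc k) = C * (1 - c*x)"
    using q by (simp_all add: B_def C_def qpoch_Suc qk)
  have F': "qpoch (a*c*q) (q^2) (Suc k) = F * (1 - a*c/q*x^2)"
    and H': "qpoch (a*b*q) (q^2) (Suc k) = H * (1 - a*b/q*x^2)"
    unfolding F_def H_def qpoch_Suc q2k using q by (simp_all add: power2_eq_square)
  have F0: "qpoch (a*c/q) (q^2) (Suc k) = (1 - a*c/q) * F"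
    and H0: "qpoch (a*b/q) (q^2) (Suc k) = (1 - a*b/q) * H"
    using q qpoch_add[of "a*c/q" "q^2" 1 k] qpoch_add[of "a*b/q" "q^2" 1 k]
    by (simp_all add: F_def H_def qpoch_Suc power2_eq_square mult.assoc)
  have A1: "qpoch (a*b*c/q) q (Suc (Suc k)) = A * (1 - a*b*c/q*x)"
    and D1: "qpoch d q (Suc (Suc k)) = D * (1 - d*x)"
    and E1: "qpoch (q/d) q (Suc (Suc k)) = E * (1 - q/d*x)"
    and J1: "qpoch (b*c*q) (q^2) (Suc (Suc k)) = J * (1 - b*c*q*x^2)"
    and M1: "qpoch (a*b*c*q/d) (q^2) (Suc (Suc k)) = M * m"
    and N1: "qpoch (a*b*c*d) (q^2) (Suc (Suc k)) = N * n"
    and L1: "qpoch (a/q) q (Suc (Suc k)) = L * g"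
    unfolding A_def D_def E_def J_def M_def N_def L_def m_def n_def g_def
      qpoch_Suc[of _ _ "Suc k"] q2k' qk' by rule+
  have L2: "qpoch (a/q) q (Suc (Suc (Suc k))) = L * g * h"
    using q by (simp add: qpoch_Suc[of _ _ "Suc (Suc k)"] L1 qk'' h_def del: power_Suc)
  \<comment> \<open>The prefactors in \<open>A2\<close>, \<open>L3\<close>, \<open>M2\<close>,
    \<open>N2\<close> are those of \<open>step_ratio\<close>. They absorb the shift from
    \<open>a\<close> to \<open>a*q^2\<close>, so that only shifted factorials belonging to
    \<open>a\<close> remain.\<close>
  have A2: "(1 - a*b*c/q) * (1 - a*b*c/q*q) * qpoch (a*q^2*b*c/q) q (Suc k)
      = A * (1 - a*b*c/q*x) * (1 - a*b*c*x)"
    using q qpoch_shift2[of "a*b*c/q" q "Suc k"]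
    by (simp add: A_def qk' qk'' mult_ac del: power_Suc)
  have L3: "(1 - a/q) * (1 - a/q*q) * qpoch (a*q^2/q) q (Suc k) = L * g * h"
    using q qpoch_shift2[of "a/q" q "Suc k"]
    by (simp add: L_def g_def h_def qk' qk'' mult_ac del: power_Suc)
  have M2: "(1 - a*b*c*q/d) * qpoch (a*q^2*b*c*q/d) (q^2) (Suc k) = M * m"
    using qpoch_shift[of "a*b*c*q/d" "q^2" "Suc k"]
    by (simp add: M_def m_def q2k' mult_ac del: power_Suc)
  have N2: "(1 - a*b*c*d) * qpoch (a*q^2*b*c*d) (q^2) (Suc k) = N * n"
    using qpoch_shift[of "a*b*c*d" "q^2" "Suc k"]
    by (simp add: N_def n_def q2k' mult_ac del: power_Suc)
  have F2: "qpoch (a*q^2*c/q) (q^2) (Suc k) = F * (1 - a*c/q*x^2)"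
    and H2: "qpoch (a*q^2*b/q) (q^2) (Suc k) = H * (1 - a*b/q*x^2)"
    using q F' H' by (simp_all add: power2_eq_square mult_ac)
  have nz': "y \<noteq> 0" "m \<noteq> 0" "n \<noteq> 0" "g \<noteq> 0" "h \<noteq> 0"
    using nz(1,5,6)[of "Suc k"] nz(2,3)[of "Suc (Suc k)"] nz(4)[of "Suc (Suc (Suc k))"]
    unfolding Q' B' C' M1 N1 L2 y_def by auto
  have 1: "G_term q b c d a (Suc k)
      = K * (x * (1 - a*b*c/q*x^3) * (1 - a*b/q) * (1 - a*c/q))"
    unfolding G_term_def G_den_def qpochs_Cons qpochs_Nil power_int_term[OF q] Q' B' C' F0 H0 qk'
      A_def[symmetric] D_def[symmetric] E_def[symmetric] J_def[symmetric] M_def[symmetric]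
      N_def[symmetric] L_def[symmetric] K_def y_def
    by (simp only: times_divide_eq_left times_divide_eq_right times_divide_times_eq
          divide_divide_eq_left mult_1_left mult_1_right mult_ac)
  have 2: "step_ratio q b c d a * G_term q b c d (a*q^2) (Suc k)
      = K * (x * (1 - a*q*b*c*x^3) * (1 - a*b*c/q*x) * (1 - a*b*c*x) * (1 - a*d/q) * (1 - a/d)
          * (1 - a*b/q*x^2) * (1 - a*c/q*x^2)) / (m * n * g * h)"
  proof -
    have "a*q^2*b*c * (x^3 / q) = a*q*b*c*x^3"
      using q by (simp add: power2_eq_square)
    then have "step_ratio q b c d a * G_term q b c d (a*q^2) (Suc k)
      = ((1 - a*q*b*c*x^3) * x * D * E * J * (1 - a*d/q) * (1 - a/d)
          * (F * (1 - a*c/q*x^2)) * (H * (1 - a*b/q*x^2))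
          * ((1 - a*b*c/q) * (1 - a*b*c/q*q) * qpoch (a*q^2*b*c/q) q (Suc k)))
        / (Q * (1 - x^2) * (B * (1 - b*x)) * (C * (1 - c*x))
          * ((1 - a*b*c*q/d) * qpoch (a*q^2*b*c*q/d) (q^2) (Suc k))
          * ((1 - a*b*c*d) * qpoch (a*q^2*b*c*d) (q^2) (Suc k))
          * ((1 - a/q) * (1 - a/q*q) * qpoch (a*q^2/q) q (Suc k)))"
      unfolding G_term_def G_den_def step_ratio_def qpochs_Cons qpochs_Nil power_int_term[OF q]
        Q' B' C' F2 H2 qk' D_def[symmetric] E_def[symmetric] J_def[symmetric]
      by (simp only: times_divide_eq_left times_divide_eq_right times_divide_times_eq
          divide_divide_eq_left mult_1_left mult_1_right mult_ac)
    also have "\<dots> = K * (x * (1 - a*q*b*c*x^3) * (1 - a*b*c/q*x) * (1 - a*b*c*x) * (1 - a*d/q)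
        * (1 - a/d) * (1 - a*b/q*x^2) * (1 - a*c/q*x^2)) / (m * n * g * h)"
      unfolding A2 M2 N2 L3 K_def y_def by (simp only: times_divide_eq_left times_divide_eq_right
          times_divide_times_eq divide_divide_eq_left mult_ac)
    finally show ?thesis .
  qed
  have 3: "step_sum q b c d a (Suc k)
      = K * - ((1 - a*b*c/q*x) * (1 - d*x) * (1 - q/d*x) * (1 - a*b/q*x^2) * (1 - a*c/q*x^2)
          * (1 - b*c*q*x^2) * (a/q * (1 - a^2*b*c*x^2))) / (m * n * g * h)"
    unfolding step_sum_def qpochs_Cons qpochs_Nil Q' B' C' F' H' A1 D1 E1 J1 M1 N1 L2 q2k' K_def y_def
    by (simp only: times_divide_eq_left times_divide_eq_right times_divide_times_eq
          divide_divide_eq_left mult_1_left mult_1_right mult_minus_left mult_minus_right minus_divide_left[symmetric] mult_ac)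
  have 4: "step_sum q b c d a k = K * - (y * (a/q * (1 - (a/q)^2*b*c*x^2))) / g"
  proof -
    have "a^2*b*c * (x^2 / q^2) = (a/q)^2*b*c*x^2"
      by (simp add: power_divide)
    then show ?thesis
      using nz'(1) unfolding step_sum_def qpochs_Cons qpochs_Nil L1 q2k K_def
        A_def[symmetric] D_def[symmetric] E_def[symmetric] J_def[symmetric] M_def[symmetric]
        N_def[symmetric] F_def[symmetric] H_def[symmetric] Q_def[symmetric] B_def[symmetric]
        C_def[symmetric]
      by (simp add: mult_ac)
  qed
  \<comment> \<open>Replacing \<open>q\<close> by \<open>d*e\<close> and \<open>a\<close> by
    \<open>\<alpha>*(d*e)\<close> removes all divisions from the identity \<open>5\<close>, as
    \<open>algebra\<close> requires.\<close>
  define \<alpha> e where "\<alpha> = a / q" and "e = q / d"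
  have qe: "q = d * e" and ae: "a = \<alpha> * (d * e)"
    using q d by (simp_all add: \<alpha>_def e_def)
  have de: "d \<noteq> 0" "e \<noteq> 0"
    using q d by (simp_all add: e_def)
  have 5: "x * (1 - a*b*c/q*x^3) * (1 - a*b/q) * (1 - a*c/q) * (m * n * g * h)
      - x * (1 - a*q*b*c*x^3) * (1 - a*b*c/q*x) * (1 - a*b*c*x) * (1 - a*d/q) * (1 - a/d)
          * (1 - a*b/q*x^2) * (1 - a*c/q*x^2)
      = - ((1 - a*b*c/q*x) * (1 - d*x) * (1 - q/d*x) * (1 - a*b/q*x^2) * (1 - a*c/q*x^2)
          * (1 - b*c*q*x^2) * (a/q * (1 - a^2*b*c*x^2)))
        + y * (a/q * (1 - (a/q)^2*b*c*x^2)) * (m * n * h)"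
  proof -
    have s: "\<alpha>*(d*e)*b*c/q = \<alpha>*b*c" "a*b/q = \<alpha>*b" "a*c/q = \<alpha>*c" "a*q*b*c = \<alpha>*(d*e)^2*b*c"
      "a*b*c = \<alpha>*(d*e)*b*c" "a*d/q = \<alpha>*d" "a/d = \<alpha>*e" "q/d = e" "b*c*q = b*c*(d*e)" "a/q = \<alpha>"
      "a^2 = \<alpha>^2 * (d*e)^2" "m = 1 - \<alpha>*(d*e)*b*c*e*x^2" "n = 1 - \<alpha>*(d*e)*b*c*d*x^2"
      "g = 1 - \<alpha>*x" "h = 1 - \<alpha>*(d*e)*x"
      using de unfolding m_def n_def g_def h_def by (simp_all add: qe ae power2_eq_square mult_ac)
    show ?thesis
      unfolding s y_def by algebra
  qed
  \<comment> \<open>Stated for arbitrary \<open>p\<close> and \<open>r\<close>, so that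
    \<open>field_simps\<close> does not expand the large polynomials.\<close>
  have combine: "K * p - K * r / (m * n * g * h) = K * (p * (m * n * g * h) - r) / (m * n * g * h)" for p r
    using nz' by (simp add: field_simps)
  have split: "K * (- p + r * (m * n * h)) / (m * n * g * h)
      = K * - p / (m * n * g * h) - K * - r / g" for p r
    using nz' by (simp add: field_simps)
  have "G_term q b c d a (Suc k) - step_ratio q b c d a * G_term q b c d (a*q^2) (Suc k)
      = K * (x * (1 - a*b*c/q*x^3) * (1 - a*b/q) * (1 - a*c/q) * (m * n * g * h)
      - x * (1 - a*q*b*c*x^3) * (1 - a*b*c/q*x) * (1 - a*b*c*x) * (1 - a*d/q) * (1 - a/d)
          * (1 - a*b/q*x^2) * (1 - a*c/q*x^2)) / (m * n * g * h)"
    unfolding 1 2 by (rule combine)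
  also have "\<dots> = step_sum q b c d a (Suc k) - step_sum q b c d a k"
    unfolding 3 4 5 by (rule split)
  finally show ?thesis .
qed
lemma step_partial_sum:
  assumes q: "q \<noteq> 0" and d: "d \<noteq> 0"
    and nz: "\<And>n. qpoch (q^2) (q^2) n \<noteq> 0" "\<And>n. qpoch (a*b*c*q/d) (q^2) n \<noteq> 0"
      "\<And>n. qpoch (a*b*c*d) (q^2) n \<noteq> 0" "\<And>n. qpoch (a/q) q n \<noteq> 0"
      "\<And>n. qpoch (b*q) q n \<noteq> 0" "\<And>n. qpoch (c*q) q n \<noteq> 0"
  shows "(\<Sum>k\<le>K. G_term q b c d a k - step_ratio q b c d a * G_term q b c d (a*q^2) k)
    = step_sum q b c d a K"
proof (induction K)
  case 0
  define \<alpha> e where "\<alpha> = a / q" and "e = q / d"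
  have qe: "q = d * e" and ae: "a = \<alpha> * (d * e)"
    using q d by (simp_all add: \<alpha>_def e_def)
  have de: "d \<noteq> 0" "e \<noteq> 0"
    using q d by (simp_all add: e_def)
  \<comment> \<open>The common denominator of \<open>step_ratio\<close> and of
    \<open>step_sum\<close> at index 0.\<close>
  define w where "w = (1 - \<alpha>*(d*e)*b*c*e) * (1 - \<alpha>*(d*e)*b*c*d) * (1 - \<alpha>) * (1 - \<alpha>*(d*e))"
  have s: "a*b*c/q = \<alpha>*b*c" "\<alpha>*b*c*q = \<alpha>*(d*e)*b*c" "\<alpha>*q = \<alpha>*(d*e)"
      "a*d/q = \<alpha>*d" "a/d = \<alpha>*e" "q/d = e" "b*c*q = b*c*(d*e)" "a/q = \<alpha>"
      "a^2*b*c = \<alpha>^2*b*c*(d*e)^2" "a*b*c*q/d = \<alpha>*(d*e)*b*c*e" "a*b*c*d = \<alpha>*(d*e)*b*c*d"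
      "a*q^2*b*c/q = \<alpha>*(d*e)^2*b*c"
    using de by (simp_all add: qe ae power2_eq_square mult_ac)
  have "qpoch \<alpha> q 2 = (1 - \<alpha>) * (1 - \<alpha>*(d*e))"
    by (simp add: qpoch_Suc numeral_2_eq_2 flip: qe)
  then have w: "w \<noteq> 0"
    using nz(2,3)[of 1] nz(4)[of 2] unfolding s w_def by (simp add: qpoch_Suc)
  have G0: "G_term q b c d z 0 = 1 - z*b*c/q" for z
    by (simp add: G_term_def G_den_def power_int_minus divide_inverse)
  have first: "G_term q b c d a 0 = 1 - \<alpha>*b*c"
    unfolding G0 s ..
  have second: "step_ratio q b c d a * G_term q b c d (a*q^2) 0
      = (1 - \<alpha>*(d*e)^2*b*c) * (1 - \<alpha>*b*c) * (1 - \<alpha>*(d*e)*b*c) * (1 - \<alpha>*d) * (1 - \<alpha>*e) / w"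
    unfolding step_ratio_def G0 s w_def
    by (simp only: times_divide_eq_left times_divide_eq_right mult_ac)
  have third: "step_sum q b c d a 0
      = - (1 - \<alpha>*b*c) * (1 - d) * (1 - e) * (1 - b*c*(d*e)) * (\<alpha> * (1 - \<alpha>^2*b*c*(d*e)^2)) / w"
    unfolding step_sum_def qpochs_Cons qpochs_Nil qpoch_Suc qpoch_0 power_0 power_Suc mult_1_left
      mult_1_right s w_def
    by (simp only: mult_minus_left mult_minus_right mult_ac)
  have combine: "p - r / w = t / w" if "p * w - r = t" for p r t
    using w that by (simp add: field_simps)
  have poly: "(1 - \<alpha>*b*c) * w - (1 - \<alpha>*(d*e)^2*b*c) * (1 - \<alpha>*b*c) * (1 - \<alpha>*(d*e)*b*c)
        * (1 - \<alpha>*d) * (1 - \<alpha>*e)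
      = - (1 - \<alpha>*b*c) * (1 - d) * (1 - e) * (1 - b*c*(d*e)) * (\<alpha> * (1 - \<alpha>^2*b*c*(d*e)^2))"
    using certificate_start[of \<alpha> b c d e] unfolding w_def mult.assoc .
  have "G_term q b c d a 0 - step_ratio q b c d a * G_term q b c d (a*q^2) 0 = step_sum q b c d a 0"
    unfolding first second third by (rule combine[OF poly])
  then show ?case
    by simp
next
  case (Suc K)
  then show ?case
    using step_partial_sum_Suc[OF assms, of K] by simp
qed

section \<open>Geometric domination and limits of the series\<close>

lemma G_term_bounded:
  assumes q: "0 < norm q" "norm q < 1" and d: "d \<noteq> 0"
    and nz: "qpoch_inf (q^2) (q^2) \<noteq> 0" "qpoch_inf (a*b*c*q/d) (q^2) \<noteq> 0"
      "qpoch_inf (a*b*c*d) (q^2) \<noteq> 0" "qpoch_inf (a/q) q \<noteq> 0"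
      "qpoch_inf (b*q) q \<noteq> 0" "qpoch_inf (c*q) q \<noteq> 0"
  shows "\<exists>M. \<forall>n k. norm (G_term q b c d (a * (q^2)^n) k) \<le> M * norm q ^ k"
proof -
  define p where "p = q^2"
  have q0: "q \<noteq> 0" and p: "norm p < 1" "norm p \<le> 1"
    using q by (auto simp: p_def norm_power power_less_one_iff power_le_one)
  \<comment> \<open>Shifting by powers of 1 changes nothing, so the uniform bound also serves the
    factors free of \<open>a\<close>.\<close>
  have fixed: "\<exists>M. \<forall>(n::nat) k. norm (qpoch z r k) \<le> M" if "norm r < 1" for z r
    using qpoch_shift_bounded[OF that, of 1 z] by simp
  have fixed': "\<exists>M. \<forall>(n::nat) k. norm (inverse (qpoch z r k)) \<le> M"
    if "norm r < 1" "qpoch_inf z r \<noteq> 0" for z r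
    using inverse_qpoch_shift_bounded[OF that] by (metis mult_1_right power_0)
  have lin: "\<exists>M. \<forall>n k. norm (1 - a*b*c/q * p ^ n * (q ^ k) ^ 3) \<le> M"
  proof (intro exI allI)
    fix n k
    have "norm (p ^ n * (q ^ k) ^ 3) \<le> 1"
      using q p by (simp add: norm_mult norm_power power_le_one mult_le_one)
    then have "norm (a*b*c/q) * norm (p ^ n * (q ^ k) ^ 3) \<le> norm (a*b*c/q)"
      by (simp add: mult_left_le)
    then have "norm (a*b*c/q * p ^ n * (q ^ k) ^ 3) \<le> norm (a*b*c/q)"
      unfolding norm_mult[symmetric] by (simp add: mult.assoc)
    then show "norm (1 - a*b*c/q * p ^ n * (q ^ k) ^ 3) \<le> 1 + norm (a*b*c/q)"
      using norm_triangle_ineq4[of 1 "a*b*c/q * p ^ n * (q ^ k) ^ 3"] by simp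
  qed
  have inv_a: "\<exists>M. \<forall>n k. norm (inverse (qpoch (a/q * p ^ n) q k)) \<le> M"
    using inverse_qpoch_shift_bounded[OF q(2) nz(4)] unfolding p_def power_mult[symmetric] by metis
  \<comment> \<open>The summand without \<open>q ^ k\<close>, with quotients written as products by
    inverses. Each factor is bounded uniformly in \<open>n\<close> and \<open>k\<close>, and the
    removed power supplies the geometric majorant.\<close>
  define f where "f = (\<lambda>n k. (1 - a*b*c/q * p ^ n * (q ^ k) ^ 3)
     * (qpoch (a*b*c/q * p ^ n) q k * (qpoch d q k * qpoch (q/d) q k))
     * (qpoch (a*c/q * p ^ n) p k * (qpoch (a*b/q * p ^ n) p k * qpoch (b*c*q) p k))
     * ((inverse (qpoch p p k) * (inverse (qpoch (a*b*c*q/d * p ^ n) p k)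
            * inverse (qpoch (a*b*c*d * p ^ n) p k)))
        * (inverse (qpoch (a/q * p ^ n) q k)
            * (inverse (qpoch (b*q) q k) * inverse (qpoch (c*q) q k)))))"
  have "\<exists>M. \<forall>n k. norm (f n k) \<le> M"
    unfolding f_def using nz p q
    by (intro uniformly_bounded_mult lin inv_a fixed fixed' inverse_qpoch_shift_bounded
        qpoch_shift_bounded) (auto simp: p_def)
  then obtain M where M: "norm (f n k) \<le> M" for n k
    by blast
  have "G_term q b c d (a * (q^2)^n) k = f n k * q ^ k" for n k
    unfolding G_term_def G_den_def power_int_term[OF q0] f_def p_def[symmetric]
    by (simp add: divide_inverse mult_ac)
  then show ?thesis
    by (intro exI[of _ M]) (simp add: norm_mult norm_power M mult_right_mono)
qed

lemma G_term_summable: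
  assumes "norm q < 1" "\<And>k. norm (G_term q b c d a k) \<le> M * norm q ^ k"
  shows "summable (G_term q b c d a)"
proof (rule summable_comparison_test')
  show "summable (\<lambda>k. M * norm q ^ k)"
    using assms(1) by (intro summable_mult summable_geometric) simp
  show "norm (G_term q b c d a k) \<le> M * norm q ^ k" for k
    by (rule assms(2))
qed

lemma step_sum_LIMSEQ:
  assumes q: "0 < norm q" "norm q < 1"
    and nz: "qpoch_inf (q^2) (q^2) \<noteq> 0" "qpoch_inf (a*b*c*q/d) (q^2) \<noteq> 0"
      "qpoch_inf (a*b*c*d) (q^2) \<noteq> 0" "qpoch_inf (a/q) q \<noteq> 0"
      "qpoch_inf (b*q) q \<noteq> 0" "qpoch_inf (c*q) q \<noteq> 0"
  shows "step_sum q b c d a \<longlonglongrightarrow> - step_defect q b c d a"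
proof -
  have p: "norm (q^2) < 1"
    using q by (simp add: norm_power power_less_one_iff)
  have "(\<lambda>k. (q^2) ^ k) \<longlonglongrightarrow> 0"
    using p by (rule LIMSEQ_power_zero)
  then have "step_sum q b c d a \<longlonglongrightarrow> (- (a/q) * (1 - a^2*b*c * 0))
     * (qpochs_inf [a*b*c/q, d, q/d] q * qpochs_inf [a*c*q, a*b*q] (q^2) * qpoch_inf (b*c*q) (q^2))
     / (qpoch_inf (q^2) (q^2) * qpochs_inf [a*b*c*q/d, a*b*c*d] (q^2)
        * qpoch_inf (a/q) q * qpochs_inf [b*q, c*q] q)"
    unfolding step_sum_def qpochs_Cons qpochs_Nil qpochs_inf_Cons qpochs_inf_Nil using nz
    by (intro tendsto_intros LIMSEQ_Suc qpoch_LIMSEQ p q) simp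
  also have "(- (a/q) * (1 - a^2*b*c * 0))
     * (qpochs_inf [a*b*c/q, d, q/d] q * qpochs_inf [a*c*q, a*b*q] (q^2) * qpoch_inf (b*c*q) (q^2))
     / (qpoch_inf (q^2) (q^2) * qpochs_inf [a*b*c*q/d, a*b*c*d] (q^2)
        * qpoch_inf (a/q) q * qpochs_inf [b*q, c*q] q) = - step_defect q b c d a"
    unfolding step_defect_def by (simp add: mult_ac)
  finally show ?thesis .
qed

text \<open>The partial sums of the difference of the two series have two limits, one from
  summability and one from the closed form \<open>step_sum\<close>; these must agree.\<close>

lemma G_contiguous:
  assumes q: "0 < norm q" "norm q < 1" and d: "d \<noteq> 0"
    and nz: "qpoch_inf (q^2) (q^2) \<noteq> 0" "qpoch_inf (a*b*c*q/d) (q^2) \<noteq> 0"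
      "qpoch_inf (a*b*c*d) (q^2) \<noteq> 0" "qpoch_inf (a/q) q \<noteq> 0"
      "qpoch_inf (b*q) q \<noteq> 0" "qpoch_inf (c*q) q \<noteq> 0"
  shows "G q b c d a = step_ratio q b c d a * G q b c d (a*q^2) - step_defect q b c d a"
proof -
  have p: "norm (q^2) < 1" and q0: "q \<noteq> 0"
    using q by (auto simp: norm_power power_less_one_iff)
  obtain M where M: "norm (G_term q b c d (a * (q^2)^n) k) \<le> M * norm q ^ k" for n k
    using G_term_bounded[OF assms] by blast
  \<comment> \<open>The cases \<open>n = 0\<close> and \<open>n = 1\<close> of the uniform bound
    treat the two series.\<close>
  have sm: "summable (G_term q b c d a)" "summable (G_term q b c d (a*q^2))"
    using M[of 0] M[of 1] by (auto intro!: G_term_summable[OF q(2)])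
  have "(\<lambda>K. \<Sum>k\<le>K. G_term q b c d a k - step_ratio q b c d a * G_term q b c d (a*q^2) k)
      \<longlonglongrightarrow> G q b c d a - step_ratio q b c d a * G q b c d (a*q^2)"
    unfolding G_eq_suminf
    by (intro sums_def_le[THEN iffD1] sums_diff sums_mult summable_sums sm)
  moreover have "(\<lambda>K. \<Sum>k\<le>K. G_term q b c d a k - step_ratio q b c d a * G_term q b c d (a*q^2) k)
      \<longlonglongrightarrow> - step_defect q b c d a"
    using step_sum_LIMSEQ[OF q nz]
    by (subst step_partial_sum[OF q0 d]) (use nz in \<open>simp_all add: qpoch_nonzero[OF p] qpoch_nonzero[OF q(2)]\<close>)
  ultimately show ?thesis
    using LIMSEQ_unique by (fastforce simp: algebra_simps)
qed

section \<open>Iteration towards \<open>a = 0\<close>\<close>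

text \<open>Each summand is a rational function of \<open>a\<close> whose denominator does not
  vanish at 0, so it converges. The majorant of \<open>G_term_bounded\<close> is independent of
  \<open>n\<close>, and Tannery's theorem exchanges limit and sum.\<close>

lemma G_LIMSEQ_zero:
  assumes q: "0 < norm q" "norm q < 1" and d: "d \<noteq> 0"
    and nz: "qpoch_inf (q^2) (q^2) \<noteq> 0" "qpoch_inf (a*b*c*q/d) (q^2) \<noteq> 0"
      "qpoch_inf (a*b*c*d) (q^2) \<noteq> 0" "qpoch_inf (a/q) q \<noteq> 0"
      "qpoch_inf (b*q) q \<noteq> 0" "qpoch_inf (c*q) q \<noteq> 0"
  shows "(\<lambda>n. G q b c d (a * (q^2)^n)) \<longlonglongrightarrow> G q b c d 0"
proof -
  have p: "norm (q^2) < 1" and q0: "q \<noteq> 0"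
    using q by (auto simp: norm_power power_less_one_iff)
  obtain M where M: "norm (G_term q b c d (a * (q^2)^n) k) \<le> M * norm q ^ k" for n k
    using G_term_bounded[OF assms] by blast
  have z: "(\<lambda>n. a * (q^2)^n) \<longlonglongrightarrow> 0"
    using tendsto_mult_left[OF LIMSEQ_power_zero[OF p], of a] by simp
  have "(\<lambda>n. G_term q b c d (a * (q^2)^n) k) \<longlonglongrightarrow> G_term q b c d 0 k" for k
  proof -
    have "G_den q b c d 0 k \<noteq> 0"
      using nz by (simp add: G_den_def qpoch_nonzero[OF p] qpoch_nonzero[OF q(2)])
    then show ?thesis
      unfolding G_term_def G_den_def qpochs_Cons qpochs_Nil qpoch_def
      by (intro tendsto_intros z) (use q0 d in auto)
  qed
  then show ?thesis
    unfolding G_eq_suminf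
  proof (rule tannerys_theorem[where M = "\<lambda>k. M * norm q ^ k", THEN conjunct2, THEN conjunct2])
    show "summable (\<lambda>k. M * norm q ^ k)"
      using q by (intro summable_mult summable_geometric) simp
    show "\<forall>\<^sub>F (k, n) in sequentially \<times>\<^sub>F sequentially.
        norm (G_term q b c d (a * (q^2)^n) k) \<le> M * norm q ^ k"
      using M by (simp add: always_eventually)
  qed simp_all
qed

text \<open>The product of \<open>step_ratio\<close> at \<open>a * (q^2)^i\<close> over
  \<open>i < n\<close>. Each step contributes two factors in base \<open>q\<close> and one in base
  \<open>q^2\<close>, hence the lengths \<open>2*n\<close> and \<open>n\<close>.\<close>

definition iter_ratio :: "complex \<Rightarrow> complex \<Rightarrow> complex \<Rightarrow> complex \<Rightarrow> complex \<Rightarrow> nat \<Rightarrow> complex" where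
  "iter_ratio q b c d a n =
     qpoch (a*b*c/q) q (2*n) * qpoch (a/d) (q^2) n * qpoch (a*d/q) (q^2) n
     / (qpoch (a/q) q (2*n) * qpoch (a*b*c*q/d) (q^2) n * qpoch (a*b*c*d) (q^2) n)"

lemma iter_ratio_Suc:
  "iter_ratio q b c d a (Suc n) = iter_ratio q b c d a n * step_ratio q b c d (a * (q^2)^n)"
proof -
  have s: "qpoch z q (2 * Suc n) = qpoch z q (2*n) * ((1 - z * (q^2)^n) * (1 - z * (q^2)^n * q))" for z
    by (simp add: qpoch_Suc power_mult mult.assoc)
  show ?thesis
    unfolding iter_ratio_def step_ratio_def s qpoch_Suc
    by (simp add: mult_ac)
qed

text \<open>Finite products at \<open>a\<close> and infinite ones at \<open>a * (q^2)^n\<close>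
  recombine to infinite products at \<open>a\<close>. Those with arguments \<open>a*c*q\<close> and
  \<open>a*b*q\<close> lack their first \<open>n\<close> factors, which become the denominator of
  the second series; the prefactor \<open>a * (q^2)^n / q\<close> yields the power of
  \<open>q\<close>.\<close>

lemma iter_ratio_step_defect:
  assumes q: "0 < norm q" "norm q < 1"
    and nz: "qpoch (a*c*q) (q^2) n \<noteq> 0" "qpoch (a*b*q) (q^2) n \<noteq> 0"
  shows "iter_ratio q b c d a n * step_defect q b c d (a * (q^2)^n) =
    a * (qpochs_inf [a*b*c/q, d, q/d] q / qpochs_inf [q^2, a*b*c*q/d, a*b*c*d] (q^2))
      * (qpochs_inf [a*c*q, a*b*q, b*c*q] (q^2) / qpochs_inf [a/q, b*q, c*q] q)
      * (qpochs [a/d, a*d/q] (q^2) n / qpochs [a*c*q, a*b*q] (q^2) n * q powi (2 * int n - 1))"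
proof -
  define p where "p = q^2"
  have p: "norm p < 1" and q0: "q \<noteq> 0"
    using q by (auto simp: p_def norm_power power_less_one_iff)
  have "q powi (2 * int n - 1) = q powi int (2 * n) / q"
    using q0 by (simp add: power_int_diff)
  then have pw: "q powi (2 * int n - 1) = p ^ n / q"
    by (simp only: power_int_of_nat power_mult p_def)
  have sq: "qpoch_inf z q = qpoch z q (2*n) * qpoch_inf (z * p ^ n) q" for z
    using qpoch_inf_split[OF q(2), of z "2*n"] by (simp add: power_mult p_def)
  have sp: "qpoch_inf z p = qpoch z p n * qpoch_inf (z * p ^ n) p" for z
    by (rule qpoch_inf_split[OF p])
  have comm: "a * p ^ n * b * c / q = a*b*c/q * p ^ n" "a * p ^ n * b * c * q / d = a*b*c*q/d * p ^ n"
    "a * p ^ n * b * c * d = a*b*c*d * p ^ n" "a * p ^ n / q = a/q * p ^ n"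
    "a * p ^ n * c * q = a*c*q * p ^ n" "a * p ^ n * b * q = a*b*q * p ^ n"
    by simp_all
  show ?thesis
    using nz unfolding iter_ratio_def step_defect_def pw p_def[symmetric] qpochs_Cons qpochs_Nil
      qpochs_inf_Cons qpochs_inf_Nil comm sq[of "a*b*c/q"] sq[of "a/q"] sp[of "a*b*c*q/d"]
      sp[of "a*b*c*d"] sp[of "a*c*q"] sp[of "a*b*q"]
    by (simp add: mult_ac)
qed

section \<open>The transformation as the limit of the iterated relation\<close>

theorem theorem3p11:
  fixes q a b c d :: complex
  assumes "0 < norm q" and "norm q < 1" and "d \<noteq> 0"
    and "\<forall>k. G_den q b c d a k \<noteq> 0"
    and "\<forall>k. G_den q b c d 0 k \<noteq> 0"
    and "qpoch_inf (a/q) q * qpoch_inf (a*b*c*q/d) (q^2) * qpoch_inf (a*b*c*d) (q^2) \<noteq> 0"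
    and "qpochs_inf [q^2, a*b*c*q/d, a*b*c*d] (q^2) \<noteq> 0"
    and "qpochs_inf [a/q, b*q, c*q] q \<noteq> 0"
    and "\<forall>k. qpochs [a*c*q, a*b*q] (q^2) k \<noteq> 0"
  shows "G q b c d a =
      qpoch_inf (a*b*c/q) q * qpoch_inf (a/d) (q^2) * qpoch_inf (a*d/q) (q^2)
        / (qpoch_inf (a/q) q * qpoch_inf (a*b*c*q/d) (q^2) * qpoch_inf (a*b*c*d) (q^2))
        * G q b c d 0
      - a * (qpochs_inf [a*b*c/q, d, q/d] q / qpochs_inf [q^2, a*b*c*q/d, a*b*c*d] (q^2))
          * (qpochs_inf [a*c*q, a*b*q, b*c*q] (q^2) / qpochs_inf [a/q, b*q, c*q] q)
          * (\<Sum>k. qpochs [a/d, a*d/q] (q^2) k / qpochs [a*c*q, a*b*q] (q^2) k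
                 * q powi (2 * int k - 1))"
proof -
  note q = assms(1,2)
  have p: "norm (q^2) < 1"
    using q by (simp add: norm_power power_less_one_iff)
  have nz: "qpoch_inf (q^2) (q^2) \<noteq> 0" "qpoch_inf (a*b*c*q/d) (q^2) \<noteq> 0"
      "qpoch_inf (a*b*c*d) (q^2) \<noteq> 0" "qpoch_inf (a/q) q \<noteq> 0"
      "qpoch_inf (b*q) q \<noteq> 0" "qpoch_inf (c*q) q \<noteq> 0"
    using assms(7,8) by auto
  define P where "P = qpoch_inf (a*b*c/q) q * qpoch_inf (a/d) (q^2) * qpoch_inf (a*d/q) (q^2)
        / (qpoch_inf (a/q) q * qpoch_inf (a*b*c*q/d) (q^2) * qpoch_inf (a*b*c*d) (q^2))"
  define C where "C = a * (qpochs_inf [a*b*c/q, d, q/d] q / qpochs_inf [q^2, a*b*c*q/d, a*b*c*d] (q^2))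
          * (qpochs_inf [a*c*q, a*b*q, b*c*q] (q^2) / qpochs_inf [a/q, b*q, c*q] q)"
  define T where "T = (\<lambda>k. qpochs [a/d, a*d/q] (q^2) k / qpochs [a*c*q, a*b*q] (q^2) k
                 * q powi (2 * int k - 1))"
  have step: "G q b c d (a * (q^2)^n) = step_ratio q b c d (a * (q^2)^n) * G q b c d (a * (q^2)^Suc n)
      - step_defect q b c d (a * (q^2)^n)" for n
  proof -
    have "qpoch_inf (a * (q^2)^n * b*c*q/d) (q^2) \<noteq> 0" "qpoch_inf (a * (q^2)^n * b*c*d) (q^2) \<noteq> 0"
      "qpoch_inf (a * (q^2)^n / q) q \<noteq> 0"
      using qpoch_inf_shift_nonzero[OF p nz(2), of n] qpoch_inf_shift_nonzero[OF p nz(3), of n]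
        qpoch_inf_shift_nonzero[OF q(2) nz(4), of "2*n"]
      unfolding power_mult by (simp_all add: mult_ac)
    then show ?thesis
      using G_contiguous[OF q assms(3) nz(1) _ _ _ nz(5,6), of "a * (q^2)^n"]
      by (simp add: mult_ac)
  qed
  have defect: "iter_ratio q b c d a n * step_defect q b c d (a * (q^2)^n) = C * T n" for n
    unfolding C_def T_def using assms(9) by (intro iter_ratio_step_defect q) auto
  \<comment> \<open>Multiplying \<open>step\<close> by \<open>iter_ratio\<close> makes
    \<open>C * T n\<close> the difference of two consecutive values of
    \<open>iter_ratio q b c d a n * G q b c d (a * (q^2)^n)\<close>, so the sum telescopes.\<close>
  have partial: "(\<Sum>k<n. C * T k) = iter_ratio q b c d a n * G q b c d (a * (q^2)^n) - G q b c d a" for n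
  proof (induction n)
    case 0
    show ?case
      by (simp add: iter_ratio_def)
  next
    case (Suc n)
    then show ?case
      using arg_cong[OF step[of n], of "\<lambda>z. iter_ratio q b c d a n * z"] defect[of n]
      by (simp add: iter_ratio_Suc right_diff_distrib mult.assoc)
  qed
  have "strict_mono (\<lambda>n::nat. 2 * n)"
    by (simp add: strict_mono_def)
  then have even: "(\<lambda>n. qpoch z q (2*n)) \<longlonglongrightarrow> qpoch_inf z q" for z
    using LIMSEQ_subseq_LIMSEQ[OF qpoch_LIMSEQ[OF q(2), of z]] by (simp add: o_def)
  have "iter_ratio q b c d a \<longlonglongrightarrow> P"
    unfolding iter_ratio_def P_def using nz
    by (intro tendsto_intros qpoch_LIMSEQ even p) simp
  then have "(\<lambda>n. \<Sum>k<n. C * T k) \<longlonglongrightarrow> P * G q b c d 0 - G q b c d a"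
    unfolding partial by (intro tendsto_intros G_LIMSEQ_zero q assms(3) nz)
  then have sums: "(\<lambda>k. C * T k) sums (P * G q b c d 0 - G q b c d a)"
    by (simp add: sums_def)
  have "C * suminf T = P * G q b c d 0 - G q b c d a"
  \<comment> \<open>For nonzero \<open>C\<close>, summability of \<open>T\<close> follows from that
    of its multiple. For \<open>C = 0\<close> the product \<open>C * suminf T\<close> is 0 whatever
    \<open>suminf T\<close> is, and the limit is 0 too.\<close>
  proof (cases "C = 0")
    case True
    then have "(\<lambda>k. 0) sums (P * G q b c d 0 - G q b c d a)"
      using sums by simp
    then show ?thesis
      using True sums_unique2[OF sums_zero, of "P * G q b c d 0 - G q b c d a"] by simp
  next
    case False
    then have "summable T"
      using sums_summable[OF sums] by (simp add: summable_cmult_iff)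
    then show ?thesis
      using sums by (simp add: sums_iff suminf_mult)
  qed
  then show ?thesis
    unfolding P_def[symmetric] C_def[symmetric] T_def[symmetric] by simp
qed

end
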